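(* Let $s\in(0,n/2)$. Then there exists a positive constant $\gamma$, not depending on $u$, such that $$\iint_{\mathbb R^{n+1}}|y|^{1-2(s-[s])}|z|^{-2(1+[s])}|\mathbb E_s[u]|^2\,dz\ \le\ \gamma\int_{\mathbb R^n}|x|^{-2s}|u|^2\,dx\qquad\text{for any }u\in\mathcal D^s(\mathbb R^n).$$
   Context: Points of $\mathbb R^{n+1}=\mathbb R^n\times\mathbb R$ are written $z=(x,y)$; $[s]$ is the integer part of $s$. The fractional Laplacian is defined by $\widehat{(-\Delta)^su}=|\xi|^{2s}\hat u$ ($\hat u$ the Fourier transform on $\mathbb R^n$), and for $n>2s>0$, $\mathcal D^s(\mathbb R^n)=\{u\in L^2(\mathbb R^n;|x|^{-2s}dx):(-\Delta)^{s/2}u\in L^2(\mathbb R^n)\}$. The extension operator is $\mathbb E_s[u](x,y)=(u*P^y_s)(x)$ for $y\ne0$ (convolution on $\mathbb R^n$) and $\mathbb E_s[u](x,0)=u(x)$, where $$P^y_s(x)=\frac{\Gamma(\frac n2+s)}{\pi^{n/2}\Gamma(s)}\,\frac{|y|^{2s}}{(|x|^2+y^2)^{\frac{n+2s}2}} .$$ *)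

theory Defs
  imports "HOL-Analysis.Analysis"
begin

text \<open>Functions on \<open>\<real>\<^sup>n\<close> are complex-valued functions on \<^typ>\<open>real^'n\<close>, where \<open>n = CARD('n)\<close>.
  Elements of function spaces are represented by Lebesgue measurable functions, not by
  classes modulo equality almost everywhere.\<close>

primrec iterated_partial :: "'n::finite list \<Rightarrow> (real^'n \<Rightarrow> complex) \<Rightarrow> real^'n \<Rightarrow> complex" where
  "iterated_partial [] f = f"
| "iterated_partial (i # is) f =
     (\<lambda>x. frechet_derivative (iterated_partial is f) (at x) (axis i 1))"

text \<open>Differentiability at every order is required explicitly, since \<^const>\<open>frechet_derivative\<close>
  is unspecified at points of non-differentiability.\<close>

definition schwartz :: "(real^'n::finite \<Rightarrow> complex) \<Rightarrow> bool" where
  "schwartz f \<longleftrightarrow>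
     (\<forall>is. (\<forall>x. iterated_partial is f differentiable (at x)) \<and>
           (\<forall>k. \<exists>C. \<forall>x. norm x ^ k * cmod (iterated_partial is f x) \<le> C))"

definition fourier_transform :: "(real^'n::finite \<Rightarrow> complex) \<Rightarrow> real^'n \<Rightarrow> complex" where
  "fourier_transform f \<xi> =
     complex_of_real ((2 * pi) powr (- real CARD('n) / 2)) *
     (LINT x|lebesgue. exp (- \<i> * complex_of_real (x \<bullet> \<xi>)) * f x)"

text \<open>\<open>is_fourier u U\<close>: the function \<open>u\<close> is a tempered distribution whose distributional Fourier
  transform is (represented by) the function \<open>U\<close>. An integral formula for the transform is not
  available here, since a function in \<open>L\<^sup>2(|x|\<^sup>-\<^sup>2\<^sup>s dx)\<close> need be neither integrable nor square
  integrable. Integrability against all Schwartz functions entails that \<open>u\<close> and \<open>U\<close> are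
  measurable and locally integrable.\<close>

definition is_fourier :: "(real^'n::finite \<Rightarrow> complex) \<Rightarrow> (real^'n \<Rightarrow> complex) \<Rightarrow> bool" where
  "is_fourier u U \<longleftrightarrow>
     (\<forall>\<phi>. schwartz \<phi> \<longrightarrow>
        integrable lebesgue (\<lambda>x. u x * \<phi> x) \<and>
        integrable lebesgue (\<lambda>\<xi>. U \<xi> * \<phi> \<xi>) \<and>
        (LINT x|lebesgue. u x * fourier_transform \<phi> x) = (LINT \<xi>|lebesgue. U \<xi> * \<phi> \<xi>))"

text \<open>\<open>is_fractional_laplacian s u w\<close>: \<open>w = (-\<Delta>)\<^sup>s u\<close>. The Fourier transform of \<open>u\<close> has to be a
  function for the product \<open>|\<xi>|\<^sup>2\<^sup>s \<hat>u\<close> to make sense, because the symbol is in general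
  not smooth at the origin.\<close>

definition is_fractional_laplacian ::
    "real \<Rightarrow> (real^'n::finite \<Rightarrow> complex) \<Rightarrow> (real^'n \<Rightarrow> complex) \<Rightarrow> bool" where
  "is_fractional_laplacian s u w \<longleftrightarrow>
     (\<exists>U. is_fourier u U \<and> is_fourier w (\<lambda>\<xi>. complex_of_real (norm \<xi> powr (2 * s)) * U \<xi>))"

definition weighted_L2 :: "(real^'n::finite \<Rightarrow> real) \<Rightarrow> (real^'n \<Rightarrow> complex) set" where
  "weighted_L2 w =
     {u \<in> borel_measurable lebesgue. integrable lebesgue (\<lambda>x. w x * (cmod (u x))\<^sup>2)}"

definition D_space :: "real \<Rightarrow> (real^'n::finite \<Rightarrow> complex) set" where
  "D_space s =
     {u \<in> weighted_L2 (\<lambda>x. norm x powr (- 2 * s)).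
        \<exists>w \<in> weighted_L2 (\<lambda>x. 1). is_fractional_laplacian (s / 2) u w}"

definition convolution ::
    "(real^'n::finite \<Rightarrow> complex) \<Rightarrow> (real^'n \<Rightarrow> complex) \<Rightarrow> real^'n \<Rightarrow> complex" where
  "convolution f g x = (LINT t|lebesgue. f t * g (x - t))"

definition poisson_kernel :: "real \<Rightarrow> real \<Rightarrow> real^'n::finite \<Rightarrow> real" where
  "poisson_kernel s y x =
     Gamma (real CARD('n) / 2 + s) / (pi powr (real CARD('n) / 2) * Gamma s) *
     (\<bar>y\<bar> powr (2 * s) / ((norm x)\<^sup>2 + y\<^sup>2) powr ((real CARD('n) + 2 * s) / 2))"

definition extension :: "real \<Rightarrow> (real^'n::finite \<Rightarrow> complex) \<Rightarrow> (real^'n) \<times> real \<Rightarrow> complex" where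
  "extension s u = (\<lambda>(x, y).
     if y = 0 then u x
     else convolution u (\<lambda>t. complex_of_real (poisson_kernel s y t)) x)"

end

theory Submission
  imports Defs
begin

text \<open>The extension is convolution with a kernel whose mass is bounded independently of \<open>y\<close>, so
  Jensen's inequality gives \<open>|E\<^sub>s[u](x,y)|\<^sup>2 \<le> M \<integral> P(x - t) |u(t)|\<^sup>2 dt\<close>. By Tonelli it then suffices that
  the weight integrated against \<open>P(x - t)\<close> is at most a multiple of \<open>|t|\<^sup>-\<^sup>2\<^sup>s\<close>. Away from the origin,
  i.e. for \<open>|z| \<ge> |t|/2\<close>, this follows from integrating the kernel in \<open>x\<close> first and a power of \<open>|y|\<close>
  afterwards. For \<open>|z| < |t|/2\<close> the kernel is at most a multiple of \<open>|y|\<^sup>2\<^sup>s |t|\<^sup>-\<^sup>n\<^sup>-\<^sup>2\<^sup>s\<close>, and the weight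
  times \<open>|y|\<^sup>2\<^sup>s\<close> is dominated by \<open>|t|\<^sup>n\<^sup>-\<^sup>1\<close> times the kernel of order \<open>[s] + 1/2\<close> centred at \<open>0\<close>.\<close>

definition poisson_profile :: "real \<Rightarrow> real \<Rightarrow> 'a::euclidean_space \<Rightarrow> real" where
  "poisson_profile \<sigma> y x =
     \<bar>y\<bar> powr (2 * \<sigma>) / ((norm x)\<^sup>2 + y\<^sup>2) powr ((real DIM('a) + 2 * \<sigma>) / 2)"

lemma poisson_profile_nonneg: "poisson_profile \<sigma> y x \<ge> 0"
  by (simp add: poisson_profile_def)

lemma poisson_profile_minus_commute: "poisson_profile \<sigma> y (x - t) = poisson_profile \<sigma> y (t - x)"
  by (simp add: poisson_profile_def norm_minus_commute)

lemma borel_measurable_poisson_profile [measurable (raw)]: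
  assumes [measurable]: "f \<in> borel_measurable M" "g \<in> borel_measurable M"
  shows "(\<lambda>w. poisson_profile \<sigma> (f w) (g w)) \<in> borel_measurable M"
  unfolding poisson_profile_def by measurable

lemma poisson_profile_le_far:
  fixes x :: "'a::euclidean_space"
  assumes "\<sigma> \<ge> 0" "R > 0" and R: "R\<^sup>2 \<le> (norm x)\<^sup>2 + y\<^sup>2"
  shows "poisson_profile \<sigma> y x \<le> \<bar>y\<bar> powr (2 * \<sigma>) * R powr (- (real DIM('a) + 2 * \<sigma>))"
proof -
  have "R powr (real DIM('a) + 2 * \<sigma>) = (R powr 2) powr ((real DIM('a) + 2 * \<sigma>) / 2)"
    by (simp add: powr_powr add_divide_distrib)
  also have "R powr 2 = R\<^sup>2"
    using assms by (simp add: powr_numeral)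
  also have "R\<^sup>2 powr ((real DIM('a) + 2 * \<sigma>) / 2) \<le> ((norm x)\<^sup>2 + y\<^sup>2) powr ((real DIM('a) + 2 * \<sigma>) / 2)"
    using assms by (intro powr_mono2) auto
  finally have *: "R powr (real DIM('a) + 2 * \<sigma>) \<le> ((norm x)\<^sup>2 + y\<^sup>2) powr ((real DIM('a) + 2 * \<sigma>) / 2)" .
  have "poisson_profile \<sigma> y x \<le> \<bar>y\<bar> powr (2 * \<sigma>) / R powr (real DIM('a) + 2 * \<sigma>)"
    unfolding poisson_profile_def using * \<open>R > 0\<close> by (intro divide_left_mono) (auto intro!: mult_pos_pos)
  then show ?thesis
    by (simp only: powr_minus_divide) simp
qed

lemma poisson_profile_dyadic:
  fixes x c :: "'a::euclidean_space"
  assumes "\<sigma> > 0" "y \<noteq> 0"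
  obtains j where "x \<in> ball c (2 ^ j * \<bar>y\<bar>)"
    "poisson_profile \<sigma> y (x - c) \<le> \<bar>y\<bar> powr (2 * \<sigma>) * (2 ^ j * \<bar>y\<bar> / 2) powr (- (real DIM('a) + 2 * \<sigma>))"
proof -
  let ?P = "\<lambda>j. norm (x - c) < 2 ^ j * \<bar>y\<bar>"
  have "\<exists>j. ?P j"
    using real_arch_pow[of 2 "norm (x - c) / \<bar>y\<bar>"] assms by (auto simp: field_simps)
  define j where "j = (LEAST j. ?P j)"
  have j: "?P j"
    unfolding j_def by (rule LeastI_ex) fact
  have "(2 ^ j * \<bar>y\<bar> / 2)\<^sup>2 \<le> (norm (x - c))\<^sup>2 + y\<^sup>2"
  proof (cases j)
    case 0
    then show ?thesis by (simp add: power2_eq_square)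
  next
    case (Suc i)
    then have "\<not> ?P i"
      unfolding j_def by (metis not_less_Least lessI)
    then have "2 ^ j * \<bar>y\<bar> / 2 \<le> norm (x - c)"
      using Suc by simp
    then have "(2 ^ j * \<bar>y\<bar> / 2)\<^sup>2 \<le> (norm (x - c))\<^sup>2"
      by (intro power_mono) auto
    then show ?thesis by (smt (verit) zero_le_power2)
  qed
  then have "poisson_profile \<sigma> y (x - c) \<le> \<bar>y\<bar> powr (2 * \<sigma>) * (2 ^ j * \<bar>y\<bar> / 2) powr (- (real DIM('a) + 2 * \<sigma>))"
    using assms by (intro poisson_profile_le_far) auto
  with j that[of j] show ?thesis
    by (auto simp: dist_norm norm_minus_commute)
qed

lemma nn_integral_poisson_profile_bounded:
  assumes "\<sigma> > 0"
  obtains C where "C \<ge> 0" "\<And>y c. y \<noteq> 0 \<Longrightarrow>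
    (\<integral>\<^sup>+x. poisson_profile \<sigma> y (x - c :: 'a::euclidean_space) \<partial>lborel) \<le> ennreal C"
proof -
  let ?n = "real DIM('a)"
  define V where "V = measure lborel (ball (0::'a) 1)"
  define q where "q = (2::real) powr (- 2 * \<sigma>)"
  have q: "0 \<le> q" "q < 1"
    using assms by (auto simp: q_def powr_less_one)
  define D where "D = V * 2 powr (?n + 2 * \<sigma>)"
  have D: "D \<ge> 0" by (simp add: D_def V_def)
  have "(\<integral>\<^sup>+x. poisson_profile \<sigma> y (x - c) \<partial>lborel) \<le> ennreal (D * (1 / (1 - q)))"
    if y: "y \<noteq> 0" for y and c :: 'a
  proof -
    define a where "a j = \<bar>y\<bar> powr (2 * \<sigma>) * (2 ^ j * \<bar>y\<bar> / 2) powr (- (?n + 2 * \<sigma>))" for j :: nat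
    have a: "a j * (V * (2 ^ j * \<bar>y\<bar>) ^ DIM('a)) = D * q ^ j" for j
    proof -
      have "(2 ^ j * \<bar>y\<bar>) ^ DIM('a) = (2 powr j * \<bar>y\<bar>) powr ?n"
        using y by (simp add: powr_realpow)
      moreover have "2 ^ j * \<bar>y\<bar> / 2 = 2 powr j * \<bar>y\<bar> / 2"
        by (simp add: powr_realpow)
      moreover have "q ^ j = 2 powr (- 2 * \<sigma> * j)"
        by (simp add: q_def powr_power mult_ac)
      ultimately show ?thesis
        using y unfolding a_def D_def
        by (simp add: powr_mult powr_divide powr_powr powr_add powr_minus field_simps powr_diff)
    qed
    have "(\<integral>\<^sup>+x. poisson_profile \<sigma> y (x - c) \<partial>lborel)
        \<le> (\<integral>\<^sup>+x. (\<Sum>j. ennreal (a j) * indicator (ball c (2 ^ j * \<bar>y\<bar>)) x) \<partial>lborel)"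
    proof (rule nn_integral_mono)
      fix x :: 'a
      obtain j where j: "x \<in> ball c (2 ^ j * \<bar>y\<bar>)" "poisson_profile \<sigma> y (x - c) \<le> a j"
        using poisson_profile_dyadic[OF assms y, of x c] unfolding a_def by blast
      then have "ennreal (poisson_profile \<sigma> y (x - c))
          \<le> (\<Sum>i\<in>{j}. ennreal (a i) * indicator (ball c (2 ^ i * \<bar>y\<bar>)) x)"
        by (simp add: ennreal_leI)
      also have "\<dots> \<le> (\<Sum>i. ennreal (a i) * indicator (ball c (2 ^ i * \<bar>y\<bar>)) x)"
        by (intro sum_le_suminf) auto
      finally show "ennreal (poisson_profile \<sigma> y (x - c)) \<le> \<dots>" .
    qed
    also have "\<dots> = (\<Sum>j. ennreal (a j) * emeasure lborel (ball c (2 ^ j * \<bar>y\<bar>)))"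
    proof -
      have [measurable]: "ball c R \<in> sets borel" for R
        by simp
      show ?thesis
        by (subst nn_integral_suminf) (measurable, simp add: nn_integral_cmult_indicator)
    qed
    also have "\<dots> = (\<Sum>j. ennreal (D * q ^ j))"
    proof (intro suminf_cong)
      fix j :: nat
      have "emeasure lborel (ball c (2 ^ j * \<bar>y\<bar>)) = ennreal (measure lborel (ball c (2 ^ j * \<bar>y\<bar>)))"
        using emeasure_lborel_ball_finite[of c "2 ^ j * \<bar>y\<bar>"] by (subst emeasure_eq_ennreal_measure) auto
      also have "\<dots> = ennreal (V * (2 ^ j * \<bar>y\<bar>) ^ DIM('a))"
        by (subst content_ball_conv_unit_ball) (auto simp: V_def mult.commute)
      finally show "ennreal (a j) * emeasure lborel (ball c (2 ^ j * \<bar>y\<bar>)) = ennreal (D * q ^ j)"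
        by (simp add: a_def V_def flip: a ennreal_mult')
    qed
    also have "\<dots> = ennreal (D * (1 / (1 - q)))"
      using q D by (intro suminf_ennreal_eq sums_mult geometric_sums) auto
    finally show ?thesis .
  qed
  then show ?thesis
    using that[of "D * (1 / (1 - q))"] q D by auto
qed

lemma nn_integral_abs_le:
  fixes f :: "real \<Rightarrow> ennreal"
  assumes [measurable]: "f \<in> borel_measurable borel"
  shows "(\<integral>\<^sup>+y. f \<bar>y\<bar> \<partial>lborel) \<le> 2 * (\<integral>\<^sup>+y. f y * indicator {0..} y \<partial>lborel)"
proof -
  have "(\<integral>\<^sup>+y. f \<bar>y\<bar> \<partial>lborel) \<le> (\<integral>\<^sup>+y. f y * indicator {0..} y + f (- y) * indicator {0..} (- y) \<partial>lborel)"
    by (intro nn_integral_mono) (auto simp: indicator_def abs_if)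
  also have "\<dots> = (\<integral>\<^sup>+y. f y * indicator {0..} y \<partial>lborel) + (\<integral>\<^sup>+y. f (- y) * indicator {0..} (- y) \<partial>lborel)"
    by (rule nn_integral_add) measurable
  also have "(\<integral>\<^sup>+y. f (- y) * indicator {0..} (- y) \<partial>lborel) = (\<integral>\<^sup>+y. f y * indicator {0..} y \<partial>lborel)"
    using nn_integral_real_affine[of "\<lambda>y. f y * indicator {0..} y" "-1" 0] by simp
  finally show ?thesis by (simp add: mult_2)
qed

lemma nn_integral_abs_powr_near:
  assumes "p > -1" "r > 0"
  shows "(\<integral>\<^sup>+y. ennreal (indicator {..r} \<bar>y\<bar> * \<bar>y\<bar> powr p) \<partial>lborel) \<le> ennreal (2 * (r powr (p + 1) / (p + 1)))"
proof -
  have "(\<integral>\<^sup>+y. ennreal (indicator {..r} \<bar>y\<bar> * \<bar>y\<bar> powr p) \<partial>lborel)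
      \<le> 2 * (\<integral>\<^sup>+y. ennreal (indicator {..r} y * y powr p) * indicator {0..} y \<partial>lborel)"
    by (rule nn_integral_abs_le[of "\<lambda>y. ennreal (indicator {..r} y * y powr p)"]) measurable
  also have "(\<integral>\<^sup>+y. ennreal (indicator {..r} y * y powr p) * indicator {0..} y \<partial>lborel)
      = (\<integral>\<^sup>+y. ennreal (y powr p) * indicator {0..r} y \<partial>lborel)"
    by (intro nn_integral_cong) (auto simp: indicator_def)
  also have "\<dots> = ennreal (r powr (p + 1) / (p + 1))"
    using assms by (intro nn_integral_has_integral_lebesgue' has_integral_powr_from_0) auto
  finally show ?thesis
    by (subst ennreal_mult) (use assms in auto)
qed

lemma nn_integral_abs_powr_far:
  assumes "p < -1" "r > 0"
  shows "(\<integral>\<^sup>+y. ennreal (indicator {r<..} \<bar>y\<bar> * \<bar>y\<bar> powr p) \<partial>lborel) \<le> ennreal (2 * (r powr (p + 1) / - (p + 1)))"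
proof -
  have "(\<integral>\<^sup>+y. ennreal (indicator {r<..} \<bar>y\<bar> * \<bar>y\<bar> powr p) \<partial>lborel)
      \<le> 2 * (\<integral>\<^sup>+y. ennreal (indicator {r<..} y * y powr p) * indicator {0..} y \<partial>lborel)"
    by (rule nn_integral_abs_le[of "\<lambda>y. ennreal (indicator {r<..} y * y powr p)"]) measurable
  also have "(\<integral>\<^sup>+y. ennreal (indicator {r<..} y * y powr p) * indicator {0..} y \<partial>lborel)
      \<le> (\<integral>\<^sup>+y. ennreal (y powr p) * indicator {r..} y \<partial>lborel)"
    by (intro nn_integral_mono) (auto simp: indicator_def)
  also have "\<dots> = ennreal (- (r powr (p + 1)) / (p + 1))"
    using assms by (intro nn_integral_has_integral_lebesgue' has_integral_powr_to_inf) auto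
  also have "- (r powr (p + 1)) / (p + 1) = r powr (p + 1) / - (p + 1)"
    by (simp only: divide_minus_right minus_divide_left)
  finally show ?thesis
    using assms by (subst ennreal_mult) (auto simp: mult_left_mono)
qed

lemma weighted_poisson_profile_le:
  fixes x t :: "'a::euclidean_space"
  assumes k: "k \<ge> 0" and s: "s > 0" and sk: "s = k + a" and t: "t \<noteq> 0" and y: "y \<noteq> 0"
  shows "\<bar>y\<bar> powr (1 - 2 * a) * norm (x, y) powr (- 2 * (1 + k)) * poisson_profile s y (x - t)
    \<le> ((norm t / 2) powr (- 2 * (1 + k)) * (indicator {..norm t} \<bar>y\<bar> * \<bar>y\<bar> powr (1 - 2 * a))
          + indicator {norm t<..} \<bar>y\<bar> * \<bar>y\<bar> powr (- 1 - 2 * s)) * poisson_profile s y (x - t)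
      + (norm t / 2) powr (- 1 - 2 * s) * (indicator {..norm t} \<bar>y\<bar> * \<bar>y\<bar> powr 0)
          * poisson_profile (k + 1 / 2) y x"
    (is "?L \<le> (?A1 + ?A2) * ?P + ?B * ?Q")
proof -
  define N where "N = norm (x, y)"
  define R where "R = norm t / 2"
  have N2: "N\<^sup>2 = (norm x)\<^sup>2 + y\<^sup>2"
    by (simp add: N_def norm_Pair)
  have Ny: "\<bar>y\<bar> \<le> N" and Nx: "norm x \<le> N"
    unfolding N_def using norm_snd_le[of y x] norm_fst_le[of x y] by auto
  have N0: "N > 0" and R0: "R > 0"
    using Ny y t by (auto simp: R_def)
  have P0: "?P \<ge> 0" and Q0: "?Q \<ge> 0"
    by (simp_all add: poisson_profile_nonneg)
  have A0: "?A1 \<ge> 0" "?A2 \<ge> 0" and B0: "?B \<ge> 0"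
    by (auto simp: indicator_def)
  consider "\<bar>y\<bar> > norm t" | "\<bar>y\<bar> \<le> norm t" "N \<ge> R" | "N < R" by linarith
  then show ?thesis
  proof cases
    case 1
    have "N powr (- 2 * (1 + k)) \<le> \<bar>y\<bar> powr (- 2 * (1 + k))"
      using Ny y k by (intro powr_mono2') auto
    then have "\<bar>y\<bar> powr (1 - 2 * a) * N powr (- 2 * (1 + k)) \<le> \<bar>y\<bar> powr (1 - 2 * a) * \<bar>y\<bar> powr (- 2 * (1 + k))"
      by (intro mult_left_mono) auto
    also have "\<dots> = \<bar>y\<bar> powr (- 1 - 2 * s)"
      unfolding powr_add[symmetric] by (simp add: sk algebra_simps)
    also have "\<dots> = ?A1 + ?A2"
      using 1 by simp
    finally have "?L \<le> (?A1 + ?A2) * ?P"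
      unfolding N_def using P0 by (intro mult_right_mono) auto
    moreover have "?B * ?Q \<ge> 0"
      using B0 Q0 by simp
    ultimately show ?thesis by linarith
  next
    case 2
    have "N powr (- 2 * (1 + k)) \<le> R powr (- 2 * (1 + k))"
      using 2 R0 k by (intro powr_mono2') auto
    then have "\<bar>y\<bar> powr (1 - 2 * a) * N powr (- 2 * (1 + k)) \<le> \<bar>y\<bar> powr (1 - 2 * a) * R powr (- 2 * (1 + k))"
      by (intro mult_left_mono) auto
    also have "\<dots> = ?A1 + ?A2"
      using 2 by (simp add: R_def)
    finally have "?L \<le> (?A1 + ?A2) * ?P"
      unfolding N_def using P0 by (intro mult_right_mono) auto
    moreover have "?B * ?Q \<ge> 0"
      using B0 Q0 by simp
    ultimately show ?thesis by linarith
  next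
    case 3
    let ?n = "real DIM('a)"
    have n: "?n \<ge> 1"
      using DIM_positive[where 'a='a] by linarith
    have "R \<le> norm (x - t)"
      using norm_triangle_ineq2[of t x] Nx 3 by (simp add: norm_minus_commute R_def)
    then have "R\<^sup>2 \<le> (norm (x - t))\<^sup>2"
      using R0 by (intro power_mono) auto
    then have "R\<^sup>2 \<le> (norm (x - t))\<^sup>2 + y\<^sup>2"
      by (smt (verit) zero_le_power2)
    then have "?P \<le> \<bar>y\<bar> powr (2 * s) * R powr (- (?n + 2 * s))"
      using R0 s by (intro poisson_profile_le_far) auto
    then have "?L \<le> \<bar>y\<bar> powr (1 - 2 * a) * N powr (- 2 * (1 + k)) * (\<bar>y\<bar> powr (2 * s) * R powr (- (?n + 2 * s)))"
      unfolding N_def by (intro mult_left_mono) auto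
    also have "\<dots> = \<bar>y\<bar> powr (1 - 2 * a + 2 * s) * N powr (- (?n + 2 * k + 1)) * R powr (- (?n + 2 * s)) * N powr (?n - 1)"
    proof -
      have "N powr (- 2 * (1 + k)) = N powr (- (?n + 2 * k + 1)) * N powr (?n - 1)"
        unfolding powr_add[symmetric] by (simp add: algebra_simps)
      then show ?thesis by (simp add: powr_add)
    qed
    also have "\<dots> \<le> \<bar>y\<bar> powr (1 - 2 * a + 2 * s) * N powr (- (?n + 2 * k + 1)) * R powr (- (?n + 2 * s)) * R powr (?n - 1)"
      using 3 N0 n by (intro mult_left_mono powr_mono2) auto
    also have "\<dots> = R powr (- 1 - 2 * s) * (\<bar>y\<bar> powr (2 * (k + 1 / 2)) * N powr (- (?n + 2 * k + 1)))"
    proof -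
      have R: "R powr (- 1 - 2 * s) = R powr (- (?n + 2 * s)) * R powr (?n - 1)"
        unfolding powr_add[symmetric] by (simp add: algebra_simps)
      have y: "1 - 2 * a + 2 * s = 2 * (k + 1 / 2)"
        using sk by simp
      show ?thesis
        unfolding R y by (simp only: mult_ac)
    qed
    also have "\<bar>y\<bar> powr (2 * (k + 1 / 2)) * N powr (- (?n + 2 * k + 1)) = ?Q"
    proof -
      have "(N\<^sup>2) powr ((?n + 2 * (k + 1 / 2)) / 2) = (N powr 2) powr ((?n + 2 * (k + 1 / 2)) / 2)"
        using N0 by (simp add: powr_numeral)
      also have "\<dots> = N powr (?n + 2 * k + 1)"
        by (simp add: powr_powr add_divide_distrib add_ac)
      finally show ?thesis
        unfolding poisson_profile_def N2[symmetric] powr_minus_divide by simp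
    qed
    also have "R powr (- 1 - 2 * s) * ?Q = ?B * ?Q"
      using 3 Ny R0 y by (simp add: R_def)
    finally have "?L \<le> ?B * ?Q" .
    moreover have "(?A1 + ?A2) * ?P \<ge> 0"
      using A0 P0 by simp
    ultimately show ?thesis by linarith
  qed
qed

lemma borel_measurable_fst_snd [measurable]:
  "fst \<in> borel_measurable (borel :: ('a::euclidean_space \<times> 'b::euclidean_space) measure)"
  "snd \<in> borel_measurable (borel :: ('a::euclidean_space \<times> 'b::euclidean_space) measure)"
  by (auto simp: borel_prod[symmetric])

lemma nn_integral_weighted_poisson_profile_bounded:
  assumes k: "k \<ge> 0" and s: "s > 0" and sk: "s = k + a" and a: "a < 1"
  obtains C where "C \<ge> 0" "\<And>t :: 'a::euclidean_space. t \<noteq> 0 \<Longrightarrow>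
    (\<integral>\<^sup>+z. \<bar>snd z\<bar> powr (1 - 2 * a) * norm z powr (- 2 * (1 + k))
            * poisson_profile s (snd z) (fst z - t) \<partial>lborel) \<le> ennreal (C * norm t powr (- 2 * s))"
proof -
  obtain C1 where C1: "C1 \<ge> 0" "\<And>y c. y \<noteq> 0 \<Longrightarrow>
      (\<integral>\<^sup>+x. poisson_profile s y (x - c :: 'a) \<partial>lborel) \<le> ennreal C1"
    using nn_integral_poisson_profile_bounded[OF s] by blast
  have k': "k + 1 / 2 > 0" using k by simp
  obtain C2 where C2: "C2 \<ge> 0" "\<And>y c. y \<noteq> 0 \<Longrightarrow>
      (\<integral>\<^sup>+x. poisson_profile (k + 1 / 2) y (x - c :: 'a) \<partial>lborel) \<le> ennreal C2"
    using nn_integral_poisson_profile_bounded[OF k'] by blast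
  define D1 where "D1 = 2 powr (2 + 2 * k) * (2 / (2 - 2 * a))"
  define D2 where "D2 = 1 / s"
  define D3 where "D3 = 2 * 2 powr (1 + 2 * s)"
  have D: "D1 \<ge> 0" "D2 \<ge> 0" "D3 \<ge> 0"
    using a s by (auto simp: D1_def D2_def D3_def)
  have "(\<integral>\<^sup>+z. \<bar>snd z\<bar> powr (1 - 2 * a) * norm z powr (- 2 * (1 + k))
            * poisson_profile s (snd z) (fst z - t) \<partial>lborel)
      \<le> ennreal (((D1 + D2) * C1 + D3 * C2) * norm t powr (- 2 * s))" if t: "t \<noteq> 0" for t :: 'a
  proof -
    define r where "r = norm t"
    have r: "r > 0" using t by (simp add: r_def)
    define f1 where "f1 y = indicator {..r} \<bar>y\<bar> * \<bar>y\<bar> powr (1 - 2 * a)" for y :: real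
    define f2 where "f2 y = indicator {r<..} \<bar>y\<bar> * \<bar>y\<bar> powr (- 1 - 2 * s)" for y :: real
    define f3 where "f3 y = indicator {..r} \<bar>y\<bar> * \<bar>y\<bar> powr 0" for y :: real
    define b1 where "b1 = (r / 2) powr (- 2 * (1 + k))"
    define b3 where "b3 = (r / 2) powr (- 1 - 2 * s)"
    have half: "(r / 2) powr e = r powr e * 2 powr (- e)" for e
      using r by (simp add: powr_divide powr_minus field_simps)
    have nonneg: "f1 y \<ge> 0" "f2 y \<ge> 0" "f3 y \<ge> 0" "b1 \<ge> 0" "b3 \<ge> 0" for y
      by (auto simp: f1_def f2_def f3_def b1_def b3_def)
    have [measurable]: "f1 \<in> borel_measurable borel" "f2 \<in> borel_measurable borel" "f3 \<in> borel_measurable borel"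
      unfolding f1_def f2_def f3_def by measurable
    let ?F = "\<lambda>z :: 'a \<times> real. \<bar>snd z\<bar> powr (1 - 2 * a) * norm z powr (- 2 * (1 + k))
            * poisson_profile s (snd z) (fst z - t)"
    have slice: "(\<integral>\<^sup>+x. ?F (x, y) \<partial>lborel) \<le> ennreal C1 * ennreal (b1 * f1 y + f2 y) + ennreal C2 * ennreal (b3 * f3 y)"
      if y: "y \<noteq> 0" for y
    proof -
      have "(\<integral>\<^sup>+x. ?F (x, y) \<partial>lborel)
          \<le> (\<integral>\<^sup>+x. ennreal (b1 * f1 y + f2 y) * ennreal (poisson_profile s y (x - t))
               + ennreal (b3 * f3 y) * ennreal (poisson_profile (k + 1 / 2) y (x - 0)) \<partial>lborel)"
      proof (rule nn_integral_mono)
        fix x :: 'a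
        have "?F (x, y) \<le> (b1 * f1 y + f2 y) * poisson_profile s y (x - t)
            + b3 * f3 y * poisson_profile (k + 1 / 2) y (x - 0)"
          using weighted_poisson_profile_le[OF k s sk t y, where x = x]
          by (simp add: b1_def b3_def f1_def f2_def f3_def r_def)
        then show "ennreal (?F (x, y)) \<le> ennreal (b1 * f1 y + f2 y) * ennreal (poisson_profile s y (x - t))
               + ennreal (b3 * f3 y) * ennreal (poisson_profile (k + 1 / 2) y (x - 0))"
          using nonneg(1-3)[of y] nonneg(4,5) by (simp add: ennreal_leI poisson_profile_nonneg flip: ennreal_mult ennreal_plus)
      qed
      also have "\<dots> = ennreal (b1 * f1 y + f2 y) * (\<integral>\<^sup>+x. poisson_profile s y (x - t) \<partial>lborel)
          + ennreal (b3 * f3 y) * (\<integral>\<^sup>+x. poisson_profile (k + 1 / 2) y (x - 0 :: 'a) \<partial>lborel)"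
        by (subst nn_integral_add) (auto simp: nn_integral_cmult)
      also have "\<dots> \<le> ennreal (b1 * f1 y + f2 y) * ennreal C1 + ennreal (b3 * f3 y) * ennreal C2"
        using y by (intro add_mono mult_left_mono C1 C2) auto
      finally show ?thesis by (simp only: mult.commute)
    qed
    have "(\<integral>\<^sup>+z. ?F z \<partial>lborel) = (\<integral>\<^sup>+y. \<integral>\<^sup>+x. ?F (x, y) \<partial>lborel \<partial>lborel)"
    proof -
      have "(\<lambda>z. ennreal (?F z)) \<in> borel_measurable (lborel \<Otimes>\<^sub>M lborel)"
        unfolding lborel_prod by measurable
      from lborel_pair.nn_integral_snd[OF this] show ?thesis
        by (simp only: lborel_prod)
    qed
    also have "\<dots> \<le> (\<integral>\<^sup>+y. ennreal C1 * ennreal (b1 * f1 y + f2 y) + ennreal C2 * ennreal (b3 * f3 y) \<partial>lborel)"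
      by (intro nn_integral_mono_AE eventually_mono[OF AE_lborel_singleton[of 0]] slice)
    also have "\<dots> = (\<integral>\<^sup>+y. ennreal C1 * (ennreal b1 * ennreal (f1 y) + ennreal (f2 y))
                         + ennreal C2 * (ennreal b3 * ennreal (f3 y)) \<partial>lborel)"
      using nonneg by (simp add: ennreal_mult)
    also have "\<dots> = ennreal C1 * (ennreal b1 * (\<integral>\<^sup>+y. f1 y \<partial>lborel) + (\<integral>\<^sup>+y. f2 y \<partial>lborel))
                         + ennreal C2 * (ennreal b3 * (\<integral>\<^sup>+y. f3 y \<partial>lborel))"
      by (simp add: nn_integral_add nn_integral_cmult)
    also have "\<dots> \<le> ennreal C1 * (ennreal b1 * ennreal (2 * (r powr (1 - 2 * a + 1) / (1 - 2 * a + 1)))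
                            + ennreal (2 * (r powr (- 1 - 2 * s + 1) / - (- 1 - 2 * s + 1))))
                         + ennreal C2 * (ennreal b3 * ennreal (2 * (r powr (0 + 1) / (0 + 1))))"
      unfolding f1_def f2_def f3_def using a s r
      by (intro add_mono mult_left_mono nn_integral_abs_powr_near nn_integral_abs_powr_far) auto
    also have "\<dots> = ennreal (C1 * (b1 * (2 * (r powr (1 - 2 * a + 1) / (1 - 2 * a + 1)))
                            + (2 * (r powr (- 1 - 2 * s + 1) / - (- 1 - 2 * s + 1))))
                         + C2 * (b3 * (2 * (r powr (0 + 1) / (0 + 1)))))"
    proof -
      have "ennreal C1 * (ennreal b1 * ennreal X + ennreal Y) + ennreal C2 * (ennreal b3 * ennreal Z)
          = ennreal (C1 * (b1 * X + Y) + C2 * (b3 * Z))" if "X \<ge> 0" "Y \<ge> 0" "Z \<ge> 0" for X Y Z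
        using that C1(1) C2(1) nonneg(4,5) by (simp add: ennreal_mult)
      then show ?thesis
        by this (use a s r in auto)
    qed
    also have "b1 * (2 * (r powr (1 - 2 * a + 1) / (1 - 2 * a + 1))) = D1 * r powr (- 2 * s)"
    proof -
      have "b1 = r powr (- 2 * (1 + k)) * 2 powr (2 + 2 * k)"
        unfolding b1_def half by (simp add: add.commute)
      then have "b1 * r powr (2 - 2 * a) = 2 powr (2 + 2 * k) * (r powr (- 2 * (1 + k)) * r powr (2 - 2 * a))"
        by simp
      also have "\<dots> = 2 powr (2 + 2 * k) * r powr (- 2 * s)"
        unfolding powr_add[symmetric] by (simp add: sk algebra_simps)
      finally show ?thesis by (simp add: D1_def)
    qed
    also have "2 * (r powr (- 1 - 2 * s + 1) / - (- 1 - 2 * s + 1)) = D2 * r powr (- 2 * s)"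
      using s by (simp add: D2_def field_simps)
    also have "b3 * (2 * (r powr (0 + 1) / (0 + 1))) = D3 * r powr (- 2 * s)"
    proof -
      have "b3 = r powr (- 1 - 2 * s) * 2 powr (1 + 2 * s)"
        unfolding b3_def half by (simp add: add.commute)
      then have "b3 * r powr 1 = 2 powr (1 + 2 * s) * (r powr (- 1 - 2 * s) * r powr 1)"
        by simp
      also have "\<dots> = 2 powr (1 + 2 * s) * r powr (- 2 * s)"
        unfolding powr_add[symmetric] by simp
      finally show ?thesis using r by (simp add: D3_def)
    qed
    also have "C1 * (D1 * r powr (- 2 * s) + D2 * r powr (- 2 * s)) + C2 * (D3 * r powr (- 2 * s))
        = ((D1 + D2) * C1 + D3 * C2) * norm t powr (- 2 * s)"
      by (simp add: r_def algebra_simps)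
    finally show ?thesis .
  qed
  then show ?thesis
    using that[of "(D1 + D2) * C1 + D3 * C2"] C1 C2 D by auto
qed

text \<open>No integrability is assumed: a divergent Bochner integral has the junk value \<open>0\<close>.\<close>

lemma norm_integral_le_nn_integral:
  fixes f :: "'a \<Rightarrow> 'b::{banach, second_countable_topology}"
  shows "ennreal (norm (LINT x|M. f x)) \<le> (\<integral>\<^sup>+x. norm (f x) \<partial>M)"
  by (cases "integrable M f") (auto simp: integral_norm_bound_ennreal not_integrable_integral_eq)

lemma norm_weighted_integral_square_le:
  fixes u :: "'a \<Rightarrow> complex"
  assumes [measurable]: "u \<in> borel_measurable M" "g \<in> borel_measurable M" and g: "\<And>x. g x \<ge> 0"
  shows "ennreal ((cmod (LINT x|M. u x * complex_of_real (g x)))\<^sup>2)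
    \<le> (\<integral>\<^sup>+x. g x \<partial>M) * (\<integral>\<^sup>+x. (cmod (u x))\<^sup>2 * g x \<partial>M)"
proof -
  have "ennreal ((cmod (LINT x|M. u x * complex_of_real (g x)))\<^sup>2)
      \<le> (\<integral>\<^sup>+x. cmod (u x * complex_of_real (g x)) \<partial>M)\<^sup>2"
    using norm_integral_le_nn_integral[of M "\<lambda>x. u x * complex_of_real (g x)"]
    by (simp add: power_mono flip: ennreal_power)
  also have "(\<integral>\<^sup>+x. cmod (u x * complex_of_real (g x)) \<partial>M)
      = (\<integral>\<^sup>+x. ennreal (sqrt (g x)) * ennreal (cmod (u x) * sqrt (g x)) \<partial>M)"
    using g by (intro nn_integral_cong) (auto simp: norm_mult simp flip: ennreal_mult)
  also have "\<dots>\<^sup>2 \<le> (\<integral>\<^sup>+x. (ennreal (sqrt (g x)))\<^sup>2 \<partial>M) * (\<integral>\<^sup>+x. (ennreal (cmod (u x) * sqrt (g x)))\<^sup>2 \<partial>M)"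
    by (rule Cauchy_Schwarz_nn_integral) measurable
  also have "\<dots> = (\<integral>\<^sup>+x. g x \<partial>M) * (\<integral>\<^sup>+x. (cmod (u x))\<^sup>2 * g x \<partial>M)"
    using g by (simp add: ennreal_power power_mult_distrib)
  finally show ?thesis .
qed

lemma borel_measurable_lebesgue_complexE:
  fixes u :: "'a::euclidean_space \<Rightarrow> complex"
  assumes u: "u \<in> borel_measurable lebesgue"
  obtains v where "v \<in> borel_measurable borel" "AE x in lborel. u x = v x"
proof -
  have "(\<lambda>x. Re (u x)) \<in> borel_measurable lebesgue" "(\<lambda>x. Im (u x)) \<in> borel_measurable lebesgue"
    using u by measurable
  then obtain f g where fg: "f \<in> borel_measurable lborel" "AE x in lborel. Re (u x) = f x"
      "g \<in> borel_measurable lborel" "AE x in lborel. Im (u x) = g x"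
    by (blast dest: completion_ex_borel_measurable_real)
  show ?thesis
  proof (rule that[of "\<lambda>x. Complex (f x) (g x)"])
    have [measurable]: "f \<in> borel_measurable borel" "g \<in> borel_measurable borel"
      using fg by simp_all
    show "(\<lambda>x. Complex (f x) (g x)) \<in> borel_measurable borel"
      unfolding Complex_eq by measurable
    show "AE x in lborel. u x = Complex (f x) (g x)"
      using fg(2,4) by eventually_elim (simp add: complex_eq_iff)
  qed
qed

lemma AE_lborel_snd_nonzero: "AE z in (lborel :: ('a::euclidean_space \<times> real) measure). snd z \<noteq> 0"
proof -
  have "{z :: 'a \<times> real. snd z = 0} = UNIV \<times> {0}"
    by auto
  moreover have "emeasure lborel (UNIV \<times> {0} :: ('a \<times> real) set) = 0"
    unfolding lborel_prod[symmetric] by (subst lborel.emeasure_pair_measure_Times) auto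
  ultimately show ?thesis
    by (subst AE_iff_measurable[OF _ refl]) (auto simp: closed_Times)
qed

lemma poisson_kernel_eq:
  "poisson_kernel s y (x :: real^'n::finite) =
     Gamma (real CARD('n) / 2 + s) / (pi powr (real CARD('n) / 2) * Gamma s) * poisson_profile s y x"
  by (simp add: poisson_kernel_def poisson_profile_def)

lemma nn_integral_extension_le:
  assumes k: "k \<ge> 0" and s: "s > 0" and sk: "s = k + a" and a: "a < 1"
  obtains C where "C > 0" "\<And>u :: real^'n::finite \<Rightarrow> complex. u \<in> borel_measurable lebesgue \<Longrightarrow>
    (\<lambda>z. \<bar>snd z\<bar> powr (1 - 2 * a) * norm z powr (- 2 * (1 + k)) * (cmod (extension s u z))\<^sup>2)
      \<in> borel_measurable lebesgue \<and>
    (\<integral>\<^sup>+z. \<bar>snd z\<bar> powr (1 - 2 * a) * norm z powr (- 2 * (1 + k)) * (cmod (extension s u z))\<^sup>2 \<partial>lebesgue)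
      \<le> ennreal C * (\<integral>\<^sup>+x. norm x powr (- 2 * s) * (cmod (u x))\<^sup>2 \<partial>lebesgue)"
proof -
  obtain M where M: "M \<ge> 0" "\<And>y c. y \<noteq> 0 \<Longrightarrow>
      (\<integral>\<^sup>+x. poisson_profile s y (x - c :: real^'n) \<partial>lborel) \<le> ennreal M"
    using nn_integral_poisson_profile_bounded[OF s] by blast
  obtain K where K: "K \<ge> 0" "\<And>t :: real^'n. t \<noteq> 0 \<Longrightarrow>
    (\<integral>\<^sup>+z. \<bar>snd z\<bar> powr (1 - 2 * a) * norm z powr (- 2 * (1 + k))
            * poisson_profile s (snd z) (fst z - t) \<partial>lborel) \<le> ennreal (K * norm t powr (- 2 * s))"
    using nn_integral_weighted_poisson_profile_bounded[OF k s sk a] by blast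
  define c where "c = Gamma (real CARD('n) / 2 + s) / (pi powr (real CARD('n) / 2) * Gamma s)"
  define C where "C = c\<^sup>2 * M * K"
  define W where "W z = \<bar>snd z\<bar> powr (1 - 2 * a) * norm z powr (- 2 * (1 + k))" for z :: "(real^'n) \<times> real"
  have W0: "W z \<ge> 0" for z
    by (simp add: W_def)
  have [measurable]: "W \<in> borel_measurable borel"
    unfolding W_def by measurable
  have C: "C \<ge> 0"
    using M K by (simp add: C_def)
  have main: "(\<lambda>z. W z * (cmod (extension s u z))\<^sup>2) \<in> borel_measurable lebesgue \<and>
    (\<integral>\<^sup>+z. W z * (cmod (extension s u z))\<^sup>2 \<partial>lebesgue)
      \<le> ennreal C * (\<integral>\<^sup>+x. norm x powr (- 2 * s) * (cmod (u x))\<^sup>2 \<partial>lebesgue)"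
    if u: "u \<in> borel_measurable lebesgue" for u :: "real^'n \<Rightarrow> complex"
  proof -
    obtain v where v [measurable]: "v \<in> borel_measurable borel" and uv: "AE x in lborel. u x = v x"
      using borel_measurable_lebesgue_complexE[OF u] .
    define E where "E z = c * cmod (LINT t|lborel. v t * complex_of_real (poisson_profile s (snd z) (fst z - t)))"
      for z :: "(real^'n) \<times> real"
    have [measurable]: "E \<in> borel_measurable borel"
      unfolding E_def by measurable
    have ext: "(cmod (extension s u z))\<^sup>2 = (E z)\<^sup>2" if "snd z \<noteq> 0" for z :: "(real^'n) \<times> real"
    proof -
      obtain x y where z: "z = (x, y)" by (cases z)
      have "(LINT t|lebesgue. u t * complex_of_real (poisson_kernel s y (x - t)))
          = (LINT t|lebesgue. v t * complex_of_real (poisson_kernel s y (x - t)))"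
      proof (rule integral_cong_AE)
        show "AE t in lebesgue. u t * complex_of_real (poisson_kernel s y (x - t))
            = v t * complex_of_real (poisson_kernel s y (x - t))"
          by (rule AE_completion) (use uv in eventually_elim, simp)
        have *: "(\<lambda>t. complex_of_real (poisson_kernel s y (x - t))) \<in> borel_measurable lebesgue"
          unfolding poisson_kernel_eq by (rule measurable_completion) measurable
        show "(\<lambda>t. u t * complex_of_real (poisson_kernel s y (x - t))) \<in> borel_measurable lebesgue"
          using u * by measurable
        have "v \<in> borel_measurable lebesgue"
          by (rule measurable_completion) simp
        then show "(\<lambda>t. v t * complex_of_real (poisson_kernel s y (x - t))) \<in> borel_measurable lebesgue"
          using * by measurable
      qed
      also have "\<dots> = (LINT t|lborel. complex_of_real c * (v t * complex_of_real (poisson_profile s y (x - t))))"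
        by (subst integral_completion) (auto simp: poisson_kernel_eq c_def mult_ac)
      also have "\<dots> = complex_of_real c * (LINT t|lborel. v t * complex_of_real (poisson_profile s y (x - t)))"
        by (rule integral_mult_right_zero)
      finally show ?thesis
        using that by (simp add: z extension_def convolution_def E_def norm_mult power_mult_distrib)
    qed
    have AE: "AE z in lborel. W z * (E z)\<^sup>2 = W z * (cmod (extension s u z))\<^sup>2"
      using AE_lborel_snd_nonzero by eventually_elim (simp add: ext)
    have "(\<lambda>z. W z * (E z)\<^sup>2) \<in> borel_measurable lebesgue"
      by (rule measurable_completion) simp
    then have meas: "(\<lambda>z. W z * (cmod (extension s u z))\<^sup>2) \<in> borel_measurable lebesgue"
      by (rule borel_measurable_AE) (rule AE_completion[OF AE])
    have E_le: "ennreal ((E z)\<^sup>2) \<le> ennreal (c\<^sup>2 * M) *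
        (\<integral>\<^sup>+t. (cmod (v t))\<^sup>2 * poisson_profile s (snd z) (fst z - t) \<partial>lborel)"
      if "snd z \<noteq> 0" for z :: "(real^'n) \<times> real"
    proof -
      have "ennreal ((E z)\<^sup>2) = ennreal (c\<^sup>2) *
          ennreal ((cmod (LINT t|lborel. v t * complex_of_real (poisson_profile s (snd z) (fst z - t))))\<^sup>2)"
        by (simp add: E_def power_mult_distrib ennreal_mult)
      also have "\<dots> \<le> ennreal (c\<^sup>2) * ((\<integral>\<^sup>+t. poisson_profile s (snd z) (fst z - t) \<partial>lborel)
          * (\<integral>\<^sup>+t. (cmod (v t))\<^sup>2 * poisson_profile s (snd z) (fst z - t) \<partial>lborel))"
        by (intro mult_left_mono norm_weighted_integral_square_le) (auto simp: poisson_profile_nonneg)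
      also have "\<dots> \<le> ennreal (c\<^sup>2) * (ennreal M
          * (\<integral>\<^sup>+t. (cmod (v t))\<^sup>2 * poisson_profile s (snd z) (fst z - t) \<partial>lborel))"
        using M(2)[OF that, of "fst z"]
        by (intro mult_left_mono mult_right_mono) (auto simp: poisson_profile_minus_commute[of _ _ "fst z"])
      finally show ?thesis
        using M by (simp add: ennreal_mult mult.assoc)
    qed
    have "(\<integral>\<^sup>+z. W z * (cmod (extension s u z))\<^sup>2 \<partial>lebesgue) = (\<integral>\<^sup>+z. W z * (E z)\<^sup>2 \<partial>lborel)"
      unfolding nn_integral_completion using AE by (intro nn_integral_cong_AE) auto
    also have "\<dots> \<le> (\<integral>\<^sup>+z. (\<integral>\<^sup>+t. ennreal (c\<^sup>2 * M) * (ennreal ((cmod (v t))\<^sup>2)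
        * ennreal (W z * poisson_profile s (snd z) (fst z - t))) \<partial>lborel) \<partial>lborel)"
    proof (rule nn_integral_mono_AE, use AE_lborel_snd_nonzero in eventually_elim)
      fix z :: "(real^'n) \<times> real" assume z: "snd z \<noteq> 0"
      have "ennreal (W z * (E z)\<^sup>2) \<le> ennreal (W z) * (ennreal (c\<^sup>2 * M) *
        (\<integral>\<^sup>+t. (cmod (v t))\<^sup>2 * poisson_profile s (snd z) (fst z - t) \<partial>lborel))"
        using W0 E_le[OF z] by (simp add: ennreal_mult mult_left_mono)
      also have "\<dots> = (\<integral>\<^sup>+t. ennreal (W z) * (ennreal (c\<^sup>2 * M) *
            ennreal ((cmod (v t))\<^sup>2 * poisson_profile s (snd z) (fst z - t))) \<partial>lborel)"
        by (simp add: nn_integral_cmult)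
      also have "\<dots> = (\<integral>\<^sup>+t. ennreal (c\<^sup>2 * M) * (ennreal ((cmod (v t))\<^sup>2)
        * ennreal (W z * poisson_profile s (snd z) (fst z - t))) \<partial>lborel)"
        using W0[of z] by (intro nn_integral_cong) (simp add: ennreal_mult poisson_profile_nonneg mult_ac)
      finally show "ennreal (W z * (E z)\<^sup>2) \<le> \<dots>" .
    qed
    also have "\<dots> = (\<integral>\<^sup>+t. (\<integral>\<^sup>+z. ennreal (c\<^sup>2 * M) * (ennreal ((cmod (v t))\<^sup>2)
        * ennreal (W z * poisson_profile s (snd z) (fst z - t))) \<partial>lborel) \<partial>lborel)"
      by (rule lborel_pair.Fubini') measurable
    also have "\<dots> = (\<integral>\<^sup>+t. ennreal (c\<^sup>2 * M) * (ennreal ((cmod (v t))\<^sup>2)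
        * (\<integral>\<^sup>+z. W z * poisson_profile s (snd z) (fst z - t) \<partial>lborel)) \<partial>lborel)"
      by (simp add: nn_integral_cmult)
    also have "\<dots> \<le> (\<integral>\<^sup>+t. ennreal (c\<^sup>2 * M) * (ennreal ((cmod (v t))\<^sup>2)
        * ennreal (K * norm t powr (- 2 * s))) \<partial>lborel)"
      using K(2)[folded W_def]
      by (intro nn_integral_mono_AE eventually_mono[OF AE_lborel_singleton[of 0]] mult_left_mono) auto
    also have "\<dots> = (\<integral>\<^sup>+t. ennreal C * ennreal (norm t powr (- 2 * s) * (cmod (v t))\<^sup>2) \<partial>lborel)"
      using M K by (simp add: C_def mult_ac flip: ennreal_mult)
    also have "\<dots> = ennreal C * (\<integral>\<^sup>+t. norm t powr (- 2 * s) * (cmod (v t))\<^sup>2 \<partial>lborel)"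
      by (simp add: nn_integral_cmult)
    also have "(\<integral>\<^sup>+t. norm t powr (- 2 * s) * (cmod (v t))\<^sup>2 \<partial>lborel)
        = (\<integral>\<^sup>+t. norm t powr (- 2 * s) * (cmod (u t))\<^sup>2 \<partial>lebesgue)"
      unfolding nn_integral_completion
      by (rule nn_integral_cong_AE) (use uv in eventually_elim, simp)
    finally show ?thesis
      using meas by blast
  qed
  show ?thesis
  proof (rule that[of "C + 1"])
    show "C + 1 > 0" using C by simp
    fix u :: "real^'n \<Rightarrow> complex" assume u: "u \<in> borel_measurable lebesgue"
    have "ennreal C * (\<integral>\<^sup>+x. norm x powr (- 2 * s) * (cmod (u x))\<^sup>2 \<partial>lebesgue)
        \<le> ennreal (C + 1) * (\<integral>\<^sup>+x. norm x powr (- 2 * s) * (cmod (u x))\<^sup>2 \<partial>lebesgue)"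
      by (intro mult_right_mono ennreal_leI) auto
    with main[OF u] show "(\<lambda>z. \<bar>snd z\<bar> powr (1 - 2 * a) * norm z powr (- 2 * (1 + k)) * (cmod (extension s u z))\<^sup>2)
        \<in> borel_measurable lebesgue \<and>
      (\<integral>\<^sup>+z. \<bar>snd z\<bar> powr (1 - 2 * a) * norm z powr (- 2 * (1 + k)) * (cmod (extension s u z))\<^sup>2 \<partial>lebesgue)
        \<le> ennreal (C + 1) * (\<integral>\<^sup>+x. norm x powr (- 2 * s) * (cmod (u x))\<^sup>2 \<partial>lebesgue)"
      unfolding W_def by (blast intro: order_trans)
  qed
qed

theorem theorem1p3:
  fixes s :: real
  assumes "0 < s" and "s < real CARD('n::finite) / 2"
  shows "\<exists>\<gamma>>0. \<forall>u \<in> (D_space s :: (real^'n \<Rightarrow> complex) set).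
    integrable lebesgue (\<lambda>z :: (real^'n) \<times> real.
        \<bar>snd z\<bar> powr (1 - 2 * (s - of_int \<lfloor>s\<rfloor>)) * norm z powr (- 2 * (1 + of_int \<lfloor>s\<rfloor>))
        * (cmod (extension s u z))\<^sup>2) \<and>
    (LINT z|lebesgue.
        \<bar>snd z\<bar> powr (1 - 2 * (s - of_int \<lfloor>s\<rfloor>)) * norm z powr (- 2 * (1 + of_int \<lfloor>s\<rfloor>))
        * (cmod (extension s u z))\<^sup>2)
      \<le> \<gamma> * (LINT x|lebesgue. norm x powr (- 2 * s) * (cmod (u x))\<^sup>2)"
proof -
  have "real_of_int \<lfloor>s\<rfloor> \<ge> 0" "s = real_of_int \<lfloor>s\<rfloor> + (s - real_of_int \<lfloor>s\<rfloor>)" "s - real_of_int \<lfloor>s\<rfloor> < 1"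
    using assms by (auto simp: zero_le_floor) linarith
  then obtain C where C: "C > 0" and bound: "\<And>u :: real^'n \<Rightarrow> complex. u \<in> borel_measurable lebesgue \<Longrightarrow>
    (\<lambda>z. \<bar>snd z\<bar> powr (1 - 2 * (s - of_int \<lfloor>s\<rfloor>)) * norm z powr (- 2 * (1 + of_int \<lfloor>s\<rfloor>)) * (cmod (extension s u z))\<^sup>2)
      \<in> borel_measurable lebesgue \<and>
    (\<integral>\<^sup>+z. \<bar>snd z\<bar> powr (1 - 2 * (s - of_int \<lfloor>s\<rfloor>)) * norm z powr (- 2 * (1 + of_int \<lfloor>s\<rfloor>)) * (cmod (extension s u z))\<^sup>2 \<partial>lebesgue)
      \<le> ennreal C * (\<integral>\<^sup>+x. norm x powr (- 2 * s) * (cmod (u x))\<^sup>2 \<partial>lebesgue)"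
    using nn_integral_extension_le[of "real_of_int \<lfloor>s\<rfloor>" s "s - real_of_int \<lfloor>s\<rfloor>"] assms(1) by blast
  show ?thesis
  proof (intro exI[of _ C] conjI ballI C)
    fix u :: "real^'n \<Rightarrow> complex" assume "u \<in> D_space s"
    then have u: "u \<in> borel_measurable lebesgue"
      and int: "integrable lebesgue (\<lambda>x. norm x powr (- 2 * s) * (cmod (u x))\<^sup>2)"
      by (auto simp: D_space_def weighted_L2_def)
    define F where "F z = \<bar>snd z\<bar> powr (1 - 2 * (s - of_int \<lfloor>s\<rfloor>)) * norm z powr (- 2 * (1 + of_int \<lfloor>s\<rfloor>))
      * (cmod (extension s u z))\<^sup>2" for z :: "(real^'n) \<times> real"
    let ?I = "LINT x|lebesgue. norm x powr (- 2 * s) * (cmod (u x))\<^sup>2"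
    have I: "?I \<ge> 0"
      by (rule Bochner_Integration.integral_nonneg) simp
    have F0: "F z \<ge> 0" for z by (simp add: F_def)
    have Fm: "F \<in> borel_measurable lebesgue"
      using bound[OF u] unfolding F_def[abs_def] by blast
    have "(\<integral>\<^sup>+z. F z \<partial>lebesgue) \<le> ennreal C * ennreal ?I"
      using bound[OF u] nn_integral_eq_integral[OF int] unfolding F_def by simp
    then have le: "(\<integral>\<^sup>+z. F z \<partial>lebesgue) \<le> ennreal (C * ?I)"
      using C by (simp add: ennreal_mult')
    show "integrable lebesgue F"
      using Fm F0 le_less_trans[OF le ennreal_less_top] by (intro integrableI_nonneg) auto
    then have "ennreal (LINT z|lebesgue. F z) \<le> ennreal (C * ?I)"
      using le F0 by (simp add: nn_integral_eq_integral)
    then show "(LINT z|lebesgue. F z) \<le> C * ?I"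
      using C I by (simp add: ennreal_le_iff)
  qed
qed

end
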